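(* Let $(\mathcal{B},\mu)$ be a strictly positive atomless normalized measure algebra. Let $\sim$ be an equivalence relation on $\mathcal{B}$ such that, for all $a,b\in\mathcal{B}$, $a\sim b$ implies $\mu(a)=\mu(b)$ and $a\wedge c\sim b\wedge c$ for every $c\in\mathcal{B}$. Then for all $a,b\in\mathcal{B}$, $a\sim b$ implies $a=b$.
   Context: A strictly positive atomless normalized measure algebra $(\mathcal{B},\mu)$ is a Dedekind $\sigma$-complete Boolean algebra $\mathcal{B}$ with a countably additive $\mu:\mathcal{B}\to[0,1]$ such that $\mu(1)=1$, $\mu(a)>0$ for every $a\neq 0$, and $\mathcal{B}$ has no atoms. *)

theory Defs
  imports Complex_Main "HOL-Library.Countable_Complete_Lattices"
begin

(* The sort {boolean_algebra, countable_complete_lattice} is that of Dedekind sigma-complete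
   Boolean algebras: Sup and Inf are least upper and greatest lower bounds of countable sets,
   and are unconstrained on uncountable sets. *)

definition is_atom :: "'a::boolean_algebra \<Rightarrow> bool" where
  "is_atom a \<longleftrightarrow> a \<noteq> bot \<and> (\<forall>b. b \<le> a \<longrightarrow> b = bot \<or> b = a)"

(* The value 0 at bot is not assumed: it follows from additivity for the constant sequence bot. *)
definition sigma_additive :: "('a::{boolean_algebra,countable_complete_lattice} \<Rightarrow> real) \<Rightarrow> bool" where
  "sigma_additive \<mu> \<longleftrightarrow>
    (\<forall>A :: nat \<Rightarrow> 'a. (\<forall>i j. i \<noteq> j \<longrightarrow> inf (A i) (A j) = bot) \<longrightarrow>
      (\<lambda>n. \<mu> (A n)) sums \<mu> (SUP n. A n))"

locale atomless_measure_algebra =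
  fixes \<mu> :: "'a::{boolean_algebra,countable_complete_lattice} \<Rightarrow> real"
  assumes range: "\<mu> a \<in> {0..1}"
    and sigma_additive: "sigma_additive \<mu>"
    and normalized: "\<mu> top = 1"
    and strictly_positive: "a \<noteq> bot \<Longrightarrow> \<mu> a > 0"
    and atomless: "\<not> is_atom a"

end

theory Submission
  imports Defs
begin

text \<open>If a ~ b, meeting both sides with the complement of b gives a - b ~ 0. Equivalent
  elements have equal measure, so a - b is null by \<open>measure_bot\<close>, hence zero by strict
  positivity. Thus a lies below b, and symmetry of ~ gives equality.\<close>

lemma (in atomless_measure_algebra) measure_bot: "\<mu> bot = 0"
proof -
  \<comment> \<open>The constant sequence \<open>bot\<close> is pairwise disjoint, so its constant
    series of measures converges; the terms must then tend to 0.\<close>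
  have "(\<lambda>n::nat. \<mu> bot) sums \<mu> (SUP n::nat. bot)"
    using sigma_additive[unfolded sigma_additive_def, rule_format, of "\<lambda>n. bot"] by simp
  then have "(\<lambda>n::nat. \<mu> bot) \<longlonglongrightarrow> 0"
    by (intro summable_LIMSEQ_zero) (rule sums_summable)
  then show ?thesis
    by (simp add: LIMSEQ_const_iff)
qed

theorem corollary1:
  fixes \<mu> :: "'a::{boolean_algebra,countable_complete_lattice} \<Rightarrow> real"
    and R :: "'a \<Rightarrow> 'a \<Rightarrow> bool"
  assumes "atomless_measure_algebra \<mu>"
    and "equivp R"
    and "\<And>a b. R a b \<Longrightarrow> \<mu> a = \<mu> b \<and> (\<forall>c. R (inf a c) (inf b c))"
  shows "\<forall>a b. R a b \<longrightarrow> a = b"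
proof -
  interpret atomless_measure_algebra \<mu> by fact
  have le: "a \<le> b" if "R a b" for a b
  proof -
    have "R (inf a (- b)) (inf b (- b))"
      using assms(3)[OF that] by blast
    \<comment> \<open>Here \<open>inf b (- b)\<close> collapses to \<open>bot\<close>, whose measure
      is 0.\<close>
    then have "\<mu> (inf a (- b)) = 0"
      using assms(3) measure_bot by fastforce
    then have "inf a (- b) = bot"
      using strictly_positive by force
    then show ?thesis
      by (metis inf_shunt double_compl sup_commute shunt1 inf_commute)
  qed
  show ?thesis
    using le equivp_symp[OF assms(2)] by (blast intro: order.antisym)
qed

end
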